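(* Let $\Omega=(a,b)$, let $\sigma^-,\sigma^+\in L^\infty(\Omega)$ satisfy $\sigma^-(x)<0<\sigma^+(x)$ for a.a. $x\in\Omega$, and let $$\Sigma=\{\bm\sigma\in L^2(\Omega):\sigma^-(x)\le\sigma(x)\le\sigma^+(x)\text{ for a.a. }x\in\Omega\}.$$ Then, in $L^2_{\mathbf{C}^{-1}}(\Omega)$, $\mathrm{int}\,\Sigma=\varnothing$, and the condition $$(\mathrm{int}\,\Sigma-\bm{\widetilde\sigma}(t))\cap\mathcal{V}\neq\varnothing\qquad\text{for all }t\in I$$ is not satisfied, where $\mathcal{V}$ is the subspace of constant functions and $\widetilde\sigma$ is the stress solution for elasticity of the rod given in the context.
   Context: $a<b$, $I=[0,T]$, $T>0$. The stiffness $\bm C\in L^\infty(\Omega)$ satisfies $0<c_0\le\bm C(x)\le C_0$ for a.a. $x\in\Omega$. $L^2_{\mathbf{C}^{-1}}(\Omega)$ is $L^2(\Omega)$ with the inner product $\langle\bm\tau_1,\bm\tau_2\rangle_{\mathbf{C}^{-1}}=\int_\Omega\frac{\tau_1\tau_2}{\bm C}\,dx$ (equivalent to the usual one). The loads are $u_a,u_b\in W^{1,\infty}(I)$ (prescribed displacements of the endpoints, with $a+u_a(t)<b+u_b(t)$ for all $t>0$) and the body force $F\in W^{1,\infty}(I,L^2(\Omega))$. The stress solution for elasticity is $$\widetilde\sigma(t,x)=\omega_0\left(u_b(t)-u_a(t)+\int_\Omega\frac{1}{\bm C(z)}\int_a^zF(t,y)\,dy\,dz\right)-\int_a^xF(t,y)\,dy,\qquad\omega_0=\left(\int_\Omega\frac{dy}{\bm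 C(y)}\right)^{-1}.$$ *)

theory Defs
  imports "HOL-Analysis.Analysis"
begin

section \<open>The Hilbert space of square integrable functions as a space of a.e.-classes\<close>

definition L2_fun :: "real set \<Rightarrow> (real \<Rightarrow> real) set" where
  "L2_fun S = {f \<in> borel_measurable (lebesgue_on S). integrable (lebesgue_on S) (\<lambda>x. (f x)\<^sup>2)}"

definition L2_cls :: "real set \<Rightarrow> (real \<Rightarrow> real) \<Rightarrow> (real \<Rightarrow> real) set" where
  "L2_cls S f = {g \<in> L2_fun S. AE x in lebesgue_on S. g x = f x}"

definition L2 :: "real set \<Rightarrow> (real \<Rightarrow> real) set set" where
  "L2 S = L2_cls S ` L2_fun S"

definition L2_rep :: "(real \<Rightarrow> real) set \<Rightarrow> real \<Rightarrow> real" where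
  "L2_rep X = (SOME f. f \<in> X)"

definition L2_diff ::
  "real set \<Rightarrow> (real \<Rightarrow> real) set \<Rightarrow> (real \<Rightarrow> real) set \<Rightarrow> (real \<Rightarrow> real) set" where
  "L2_diff S X Y = L2_cls S (\<lambda>x. L2_rep X x - L2_rep Y x)"

definition C_inner ::
  "real set \<Rightarrow> (real \<Rightarrow> real) \<Rightarrow> (real \<Rightarrow> real) set \<Rightarrow> (real \<Rightarrow> real) set \<Rightarrow> real" where
  "C_inner S C X Y = (LINT x|lebesgue_on S. L2_rep X x * L2_rep Y x / C x)"

definition C_norm :: "real set \<Rightarrow> (real \<Rightarrow> real) \<Rightarrow> (real \<Rightarrow> real) set \<Rightarrow> real" where
  "C_norm S C X = sqrt (C_inner S C X X)"

definition C_dist ::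
  "real set \<Rightarrow> (real \<Rightarrow> real) \<Rightarrow> (real \<Rightarrow> real) set \<Rightarrow> (real \<Rightarrow> real) set \<Rightarrow> real" where
  "C_dist S C X Y = C_norm S C (L2_diff S X Y)"

definition C_topology ::
  "real set \<Rightarrow> (real \<Rightarrow> real) \<Rightarrow> (real \<Rightarrow> real) set topology" where
  "C_topology S C = Metric_space.mtopology (L2 S) (C_dist S C)"

text \<open>
  \<open>Metric_space.mtopology\<close> is meaningful only for an actual metric; lemma
  \<open>Metric_space_C_dist\<close> below establishes this for stiffness coefficients that are
  bounded above and away from zero.
\<close>

lemma L2_funD:
  assumes "f \<in> L2_fun S"
  shows "f \<in> borel_measurable (lebesgue_on S)" "integrable (lebesgue_on S) (\<lambda>x. (f x)\<^sup>2)"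
  using assms by (auto simp: L2_fun_def)

lemma L2_fun_prod_integrable:
  assumes f: "f \<in> L2_fun S" and g: "g \<in> L2_fun S"
    and C: "C \<in> borel_measurable (lebesgue_on S)" and "0 < c0"
    and lo: "AE x in lebesgue_on S. c0 \<le> C x"
  shows "integrable (lebesgue_on S) (\<lambda>x. f x * g x / C x)"
proof (rule Bochner_Integration.integrable_bound)
  note [measurable] = L2_funD(1)[OF f] L2_funD(1)[OF g] C
  show "integrable (lebesgue_on S) (\<lambda>x. ((f x)\<^sup>2 + (g x)\<^sup>2) / c0)"
    using L2_funD(2)[OF f] L2_funD(2)[OF g] by auto
  show "(\<lambda>x. f x * g x / C x) \<in> borel_measurable (lebesgue_on S)" by measurable
  show "AE x in lebesgue_on S. norm (f x * g x / C x) \<le> norm (((f x)\<^sup>2 + (g x)\<^sup>2) / c0)"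
    using lo
  proof eventually_elim
    case (elim x)
    have "\<bar>f x * g x\<bar> \<le> (f x)\<^sup>2 + (g x)\<^sup>2"
    proof -
      have "2 * (\<bar>f x\<bar> * \<bar>g x\<bar>) \<le> (f x)\<^sup>2 + (g x)\<^sup>2"
        using sum_squares_bound[of "\<bar>f x\<bar>" "\<bar>g x\<bar>"] by (simp add: mult.assoc)
      moreover have "0 \<le> \<bar>f x\<bar> * \<bar>g x\<bar>" by simp
      ultimately show ?thesis unfolding abs_mult by linarith
    qed
    then have "\<bar>f x * g x\<bar> / C x \<le> ((f x)\<^sup>2 + (g x)\<^sup>2) / c0"
      using elim \<open>0 < c0\<close> by (intro frac_le) auto
    then show ?case using elim \<open>0 < c0\<close> by (simp add: abs_mult)
  qed
qed

lemma L2_fun_diff: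
  assumes f: "f \<in> L2_fun S" and g: "g \<in> L2_fun S"
  shows "(\<lambda>x. f x - g x) \<in> L2_fun S"
proof -
  note [measurable] = L2_funD(1)[OF f] L2_funD(1)[OF g]
  have "integrable (lebesgue_on S) (\<lambda>x. f x * g x / 1)"
    by (rule L2_fun_prod_integrable[OF f g, where ?c0.0 = 1]) auto
  then have "integrable (lebesgue_on S) (\<lambda>x. (f x)\<^sup>2 + (g x)\<^sup>2 - 2 * (f x * g x))"
    using L2_funD(2)[OF f] L2_funD(2)[OF g] by auto
  moreover have "(f x - g x)\<^sup>2 = (f x)\<^sup>2 + (g x)\<^sup>2 - 2 * (f x * g x)" for x
    by (simp add: power2_diff)
  ultimately show ?thesis by (simp add: L2_fun_def)
qed

lemma L2_fun_uminus: "f \<in> L2_fun S \<Longrightarrow> (\<lambda>x. - f x) \<in> L2_fun S"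
  by (auto simp: L2_fun_def)

lemma L2_cls_cong:
  assumes "AE x in lebesgue_on S. f x = g x"
  shows "L2_cls S f = L2_cls S g"
  unfolding L2_cls_def using assms by (auto elim!: eventually_elim2)

lemma L2_rep_cls:
  assumes "f \<in> L2_fun S"
  shows "L2_rep (L2_cls S f) \<in> L2_fun S" "AE x in lebesgue_on S. L2_rep (L2_cls S f) x = f x"
proof -
  have "f \<in> L2_cls S f" using assms by (simp add: L2_cls_def)
  then have "L2_rep (L2_cls S f) \<in> L2_cls S f" unfolding L2_rep_def some_in_eq by blast
  then show "L2_rep (L2_cls S f) \<in> L2_fun S"
    "AE x in lebesgue_on S. L2_rep (L2_cls S f) x = f x" by (auto simp: L2_cls_def)
qed

lemma L2_rep_mem:
  assumes "X \<in> L2 S"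
  shows "L2_rep X \<in> L2_fun S" "L2_cls S (L2_rep X) = X"
proof -
  obtain f where f: "f \<in> L2_fun S" "X = L2_cls S f" using assms by (auto simp: L2_def)
  show "L2_rep X \<in> L2_fun S" using L2_rep_cls f by simp
  show "L2_cls S (L2_rep X) = X" using L2_cls_cong[OF L2_rep_cls(2)[OF f(1)]] f by simp
qed

lemma C_inner_cls:
  assumes f: "f \<in> L2_fun S" and g: "g \<in> L2_fun S"
    and C: "C \<in> borel_measurable (lebesgue_on S)"
  shows "C_inner S C (L2_cls S f) (L2_cls S g) = (LINT x|lebesgue_on S. f x * g x / C x)"
  unfolding C_inner_def
proof (rule integral_cong_AE)
  note [measurable] = C L2_funD(1)[OF f] L2_funD(1)[OF g]
    L2_funD(1)[OF L2_rep_cls(1)[OF f]] L2_funD(1)[OF L2_rep_cls(1)[OF g]]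
  show "(\<lambda>x. L2_rep (L2_cls S f) x * L2_rep (L2_cls S g) x / C x)
      \<in> borel_measurable (lebesgue_on S)" by measurable
  show "(\<lambda>x. f x * g x / C x) \<in> borel_measurable (lebesgue_on S)" by measurable
  show "AE x in lebesgue_on S.
      L2_rep (L2_cls S f) x * L2_rep (L2_cls S g) x / C x = f x * g x / C x"
    using L2_rep_cls(2)[OF f] L2_rep_cls(2)[OF g] by eventually_elim simp
qed

lemma C_norm_triangle:
  assumes f: "f \<in> L2_fun S" and g: "g \<in> L2_fun S"
    and C: "C \<in> borel_measurable (lebesgue_on S)" and c0: "0 < c0"
    and lo: "AE x in lebesgue_on S. c0 \<le> C x"
  shows "sqrt (LINT x|lebesgue_on S. (f x + g x) * (f x + g x) / C x)
    \<le> sqrt (LINT x|lebesgue_on S. f x * f x / C x) + sqrt (LINT x|lebesgue_on S. g x * g x / C x)"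
proof -
  define A B D where "A = (LINT x|lebesgue_on S. f x * f x / C x)"
    and "B = (LINT x|lebesgue_on S. f x * g x / C x)"
    and "D = (LINT x|lebesgue_on S. g x * g x / C x)"
  have iA: "integrable (lebesgue_on S) (\<lambda>x. f x * f x / C x)"
    and iB: "integrable (lebesgue_on S) (\<lambda>x. f x * g x / C x)"
    and iD: "integrable (lebesgue_on S) (\<lambda>x. g x * g x / C x)"
    using L2_fun_prod_integrable[OF _ _ C c0 lo] f g by auto
  have nn: "0 \<le> (LINT x|lebesgue_on S. h x * h x / C x)" for h :: "real \<Rightarrow> real"
    by (rule integral_nonneg_AE) (use lo c0 in \<open>auto elim!: eventually_mono\<close>)
  have A0: "0 \<le> A" and D0: "0 \<le> D" unfolding A_def D_def by (auto intro: nn)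
  have quad: "(LINT x|lebesgue_on S. (f x + r * g x) * (f x + r * g x) / C x)
      = A + 2 * r * B + r\<^sup>2 * D" for r
  proof -
    have "(\<lambda>x. (f x + r * g x) * (f x + r * g x) / C x)
        = (\<lambda>x. f x * f x / C x + 2 * r * (f x * g x / C x) + r\<^sup>2 * (g x * g x / C x))"
      by (auto simp: fun_eq_iff algebra_simps add_divide_distrib power2_eq_square)
    moreover have "integrable (lebesgue_on S) (\<lambda>x. 2 * r * (f x * g x / C x))"
      "integrable (lebesgue_on S) (\<lambda>x. r\<^sup>2 * (g x * g x / C x))"
      using iB iD by (auto simp del: times_divide_eq_right)
    ultimately show ?thesis using iA
      by (simp add: A_def B_def D_def del: times_divide_eq_right)
  qed
  have pos: "0 \<le> A + 2 * r * B + r\<^sup>2 * D" for r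
    using quad[of r] nn[of "\<lambda>x. f x + r * g x"] by simp
  have CS: "B\<^sup>2 \<le> A * D"
  proof (cases "D = 0")
    case True
    have "B = 0"
    proof (rule ccontr)
      assume "B \<noteq> 0"
      then show False using pos[of "- (A + 1) / (2 * B)"] True A0 by (simp add: field_simps)
    qed
    then show ?thesis using True by simp
  next
    case False
    then have "0 < D" using D0 by simp
    then show ?thesis using pos[of "- B / D"]
      by (simp add: field_simps power2_eq_square)
  qed
  have "B \<le> sqrt A * sqrt D"
    using CS by (metis real_le_rsqrt real_sqrt_mult)
  then have "A + 2 * B + D \<le> (sqrt A + sqrt D)\<^sup>2"
    using A0 D0 by (simp add: power2_sum)
  then have "sqrt (A + 2 * B + D) \<le> sqrt A + sqrt D"
    using A0 D0 by (intro real_le_lsqrt) auto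
  then show ?thesis using quad[of 1] by (simp add: A_def D_def)
qed

lemma Metric_space_C_dist:
  assumes C: "C \<in> borel_measurable (lebesgue_on S)" and c0: "0 < c0"
    and lo: "AE x in lebesgue_on S. c0 \<le> C x"
  shows "Metric_space (L2 S) (C_dist S C)"
proof
  note C[measurable]
  fix X Y
  show "0 \<le> C_dist S C X Y"
    unfolding C_dist_def C_norm_def C_inner_def real_sqrt_ge_0_iff
    by (rule integral_nonneg_AE) (use lo c0 in \<open>auto elim!: eventually_mono\<close>)
  show "C_dist S C X Y = C_dist S C Y X"
  proof (cases "\<exists>g \<in> L2_fun S. AE x in lebesgue_on S. g x = L2_rep X x - L2_rep Y x")
    case True
    then obtain g where g: "g \<in> L2_fun S" "AE x in lebesgue_on S. g x = L2_rep X x - L2_rep Y x"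
      by blast
    have 1: "L2_diff S X Y = L2_cls S g"
      unfolding L2_diff_def by (rule L2_cls_cong) (use g(2) in \<open>auto elim!: eventually_mono\<close>)
    have 2: "L2_diff S Y X = L2_cls S (\<lambda>x. - g x)"
      unfolding L2_diff_def by (rule L2_cls_cong) (use g(2) in \<open>auto elim!: eventually_mono\<close>)
    show ?thesis
      unfolding C_dist_def C_norm_def 1 2
      by (simp add: C_inner_cls[OF g(1) g(1) C]
          C_inner_cls[OF L2_fun_uminus[OF g(1)] L2_fun_uminus[OF g(1)] C])
  next
    case False
    have "\<not> (\<exists>g \<in> L2_fun S. AE x in lebesgue_on S. g x = L2_rep Y x - L2_rep X x)"
    proof
      assume "\<exists>g \<in> L2_fun S. AE x in lebesgue_on S. g x = L2_rep Y x - L2_rep X x"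
      then obtain g where "g \<in> L2_fun S" "AE x in lebesgue_on S. g x = L2_rep Y x - L2_rep X x"
        by blast
      then have "(\<lambda>x. - g x) \<in> L2_fun S"
        "AE x in lebesgue_on S. - g x = L2_rep X x - L2_rep Y x"
        by (auto intro: L2_fun_uminus elim!: eventually_mono)
      then have "\<exists>g \<in> L2_fun S. AE x in lebesgue_on S. g x = L2_rep X x - L2_rep Y x"
        by (intro bexI[where x = "\<lambda>x. - g x"])
      with False show False by contradiction
    qed
    then have "L2_diff S X Y = {}" "L2_diff S Y X = {}"
      using False by (auto simp: L2_diff_def L2_cls_def)
    then show ?thesis by (simp add: C_dist_def)
  qed
next
  fix X Y assume XY: "X \<in> L2 S" "Y \<in> L2 S"
  note X = L2_rep_mem[OF XY(1)] and Y = L2_rep_mem[OF XY(2)]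
  note D = L2_fun_diff[OF X(1) Y(1)]
  have dist: "C_dist S C X Y =
      sqrt (LINT x|lebesgue_on S. (L2_rep X x - L2_rep Y x) * (L2_rep X x - L2_rep Y x) / C x)"
    unfolding C_dist_def C_norm_def L2_diff_def using C_inner_cls[OF D D C] by simp
  show "C_dist S C X Y = 0 \<longleftrightarrow> X = Y"
  proof
    assume "C_dist S C X Y = 0"
    then have "(LINT x|lebesgue_on S.
        (L2_rep X x - L2_rep Y x) * (L2_rep X x - L2_rep Y x) / C x) = 0"
      by (simp add: dist)
    moreover have "AE x in lebesgue_on S.
        0 \<le> (L2_rep X x - L2_rep Y x) * (L2_rep X x - L2_rep Y x) / C x"
      using lo c0 by (auto elim!: eventually_mono)
    ultimately have "AE x in lebesgue_on S.
        (L2_rep X x - L2_rep Y x) * (L2_rep X x - L2_rep Y x) / C x = 0"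
      using integral_nonneg_eq_0_iff_AE[OF L2_fun_prod_integrable[OF D D C c0 lo]] by blast
    then have "AE x in lebesgue_on S. L2_rep X x = L2_rep Y x"
      using lo by eventually_elim (use c0 in auto)
    from L2_cls_cong[OF this] show "X = Y" using X(2) Y(2) by simp
  next
    assume "X = Y" with dist show "C_dist S C X Y = 0" by simp
  qed
next
  fix X Y Z assume XYZ: "X \<in> L2 S" "Y \<in> L2 S" "Z \<in> L2 S"
  note r = L2_rep_mem(1)[OF XYZ(1)] L2_rep_mem(1)[OF XYZ(2)] L2_rep_mem(1)[OF XYZ(3)]
  note D1 = L2_fun_diff[OF r(1,2)] and D2 = L2_fun_diff[OF r(2,3)] and D3 = L2_fun_diff[OF r(1,3)]
  have dist: "C_dist S C U V =
      sqrt (LINT x|lebesgue_on S. (L2_rep U x - L2_rep V x) * (L2_rep U x - L2_rep V x) / C x)"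
    if "(\<lambda>x. L2_rep U x - L2_rep V x) \<in> L2_fun S" for U V
    unfolding C_dist_def C_norm_def L2_diff_def using C_inner_cls[OF that that C] by simp
  show "C_dist S C X Z \<le> C_dist S C X Y + C_dist S C Y Z"
    using C_norm_triangle[OF D1 D2 C c0 lo] by (simp add: dist D1 D2 D3)
qed


section \<open>Lebesgue and Sobolev spaces in time\<close>

definition Linf :: "'a measure \<Rightarrow> ('a \<Rightarrow> real) set" where
  "Linf M = {f \<in> borel_measurable M. \<exists>K. AE x in M. \<bar>f x\<bar> \<le> K}"

text \<open>Smooth functions with compact support in the open interval \<open>(0, T)\<close>.\<close>

definition test_fun :: "real \<Rightarrow> (real \<Rightarrow> real) set" where
  "test_fun T = {\<phi>. (\<forall>n t. ((deriv ^^ n) \<phi>) differentiable (at t)) \<and>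
     (\<exists>K. compact K \<and> K \<subseteq> {0<..<T} \<and> (\<forall>t. t \<notin> K \<longrightarrow> \<phi> t = 0))}"

text \<open>
  Elements of \<open>W\<^sup>1\<^sup>,\<^sup>\<infinity>(I)\<close> are evaluated at every time, so each of them is identified with
  its continuous representative; the same convention is used in \<open>W1inf_L2\<close> below.
\<close>

definition W1inf :: "real \<Rightarrow> (real \<Rightarrow> real) set" where
  "W1inf T = {u \<in> Linf (lebesgue_on {0..T}). continuous_on {0..T} u \<and>
     (\<exists>v \<in> Linf (lebesgue_on {0..T}). \<forall>\<phi> \<in> test_fun T.
        (LINT t|lebesgue_on {0..T}. u t * deriv \<phi> t) =
        - (LINT t|lebesgue_on {0..T}. v t * \<phi> t))}"

text \<open>
  Bochner integration on a bounded measurable set \<open>J\<close> of times, with values in \<open>L\<^sup>2(S)\<close>.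
  The library's Bochner integral needs a type for the target space, which is not available for
  \<open>L\<^sup>2(S)\<close> with variable \<open>S\<close>. Functions into \<open>L\<^sup>2(S)\<close> are given by representatives: the value
  at time \<open>t\<close> is the class of \<open>f t\<close>.
\<close>

definition L2_norm :: "real set \<Rightarrow> (real \<Rightarrow> real) \<Rightarrow> real" where
  "L2_norm S f = sqrt (LINT x|lebesgue_on S. (f x)\<^sup>2)"

definition L2_simple :: "real set \<Rightarrow> real set \<Rightarrow> (real \<Rightarrow> real \<Rightarrow> real) \<Rightarrow> bool" where
  "L2_simple J S s \<longleftrightarrow> finite (s ` J) \<and> s ` J \<subseteq> L2_fun S \<and>
     (\<forall>v \<in> s ` J. {t \<in> J. s t = v} \<in> sets lebesgue)"

definition L2_simple_integral :: "real set \<Rightarrow> (real \<Rightarrow> real \<Rightarrow> real) \<Rightarrow> real \<Rightarrow> real" where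
  "L2_simple_integral J s = (\<lambda>x. \<Sum>v \<in> s ` J. measure lebesgue {t \<in> J. s t = v} * v x)"

definition L2_strongly_measurable ::
  "real set \<Rightarrow> real set \<Rightarrow> (real \<Rightarrow> real \<Rightarrow> real) \<Rightarrow> bool" where
  "L2_strongly_measurable J S f \<longleftrightarrow>
     (AE t in lebesgue_on J. f t \<in> L2_fun S) \<and>
     (\<exists>s. (\<forall>n. L2_simple J S (s n)) \<and>
        (AE t in lebesgue_on J. (\<lambda>n. L2_norm S (\<lambda>x. f t x - s n t x)) \<longlonglongrightarrow> 0))"

definition L2_has_bochner_integral ::
  "real set \<Rightarrow> real set \<Rightarrow> (real \<Rightarrow> real \<Rightarrow> real) \<Rightarrow> (real \<Rightarrow> real) \<Rightarrow> bool" where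
  "L2_has_bochner_integral J S f y \<longleftrightarrow>
     L2_strongly_measurable J S f \<and> y \<in> L2_fun S \<and>
     (\<exists>s. (\<forall>n. L2_simple J S (s n)) \<and>
        (\<lambda>n. \<integral>\<^sup>+t. ennreal (L2_norm S (\<lambda>x. f t x - s n t x)) \<partial>lebesgue_on J) \<longlonglongrightarrow> 0 \<and>
        (\<lambda>n. L2_norm S (\<lambda>x. L2_simple_integral J (s n) x - y x)) \<longlonglongrightarrow> 0)"

definition Linf_L2 :: "real set \<Rightarrow> real set \<Rightarrow> (real \<Rightarrow> real \<Rightarrow> real) set" where
  "Linf_L2 J S = {f. L2_strongly_measurable J S f \<and>
     (\<exists>K. AE t in lebesgue_on J. L2_norm S (f t) \<le> K)}"

definition W1inf_L2 :: "real \<Rightarrow> real set \<Rightarrow> (real \<Rightarrow> real \<Rightarrow> real) set" where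
  "W1inf_L2 T S = {f \<in> Linf_L2 {0..T} S.
     (\<forall>t \<in> {0..T}. f t \<in> L2_fun S \<and>
        ((\<lambda>s. L2_norm S (\<lambda>x. f s x - f t x)) \<longlongrightarrow> 0) (at t within {0..T})) \<and>
     (\<exists>g \<in> Linf_L2 {0..T} S. \<forall>\<phi> \<in> test_fun T. \<exists>y.
        L2_has_bochner_integral {0..T} S (\<lambda>t x. deriv \<phi> t * f t x) y \<and>
        L2_has_bochner_integral {0..T} S (\<lambda>t x. \<phi> t * g t x) (\<lambda>x. - y x))}"


section \<open>The rod\<close>

definition elastic_stress ::
  "real \<Rightarrow> real \<Rightarrow> (real \<Rightarrow> real) \<Rightarrow> (real \<Rightarrow> real) \<Rightarrow> (real \<Rightarrow> real) \<Rightarrow> (real \<Rightarrow> real \<Rightarrow> real)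
    \<Rightarrow> real \<Rightarrow> real \<Rightarrow> real" where
  "elastic_stress a b C ua ub F t x =
     inverse (LINT y|lebesgue_on {a<..<b}. 1 / C y) *
       (ub t - ua t +
        (LINT z|lebesgue_on {a<..<b}. 1 / C z * (LINT y|lebesgue_on {a<..<z}. F t y)))
     - (LINT y|lebesgue_on {a<..<x}. F t y)"

definition admissible_stresses ::
  "real set \<Rightarrow> (real \<Rightarrow> real) \<Rightarrow> (real \<Rightarrow> real) \<Rightarrow> (real \<Rightarrow> real) set set" where
  "admissible_stresses S \<sigma>m \<sigma>p =
     L2_cls S ` {\<sigma> \<in> L2_fun S. AE x in lebesgue_on S. \<sigma>m x \<le> \<sigma> x \<and> \<sigma> x \<le> \<sigma>p x}"

definition constant_classes :: "real set \<Rightarrow> (real \<Rightarrow> real) set set" where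
  "constant_classes S = range (\<lambda>c. L2_cls S (\<lambda>x. c))"

end

(*
  Interior points would survive small perturbations in the weighted L^2 distance. Adding a constant
  M to a stress on an interval of length d moves it only by O(M sqrt d), but if M exceeds the
  sum of the L^infty bounds of both yield stresses, the result exceeds the upper bound on that interval,
  however small d is.
*)

theory Submission
  imports Defs
begin

text \<open>The distance is defined through representatives picked by \<open>SOME\<close>. These
  agree a.e. with \<open>f\<close> and \<open>g\<close>, so the integral can be computed from any
  members of the two classes.\<close>

lemma C_dist_cls:
  assumes f: "f \<in> L2_fun S" and g: "g \<in> L2_fun S"
    and C: "C \<in> borel_measurable (lebesgue_on S)"
  shows "C_dist S C (L2_cls S f) (L2_cls S g) = sqrt (LINT x|lebesgue_on S. (f x - g x)\<^sup>2 / C x)"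
proof -
  have "L2_diff S (L2_cls S f) (L2_cls S g) = L2_cls S (\<lambda>x. f x - g x)"
    unfolding L2_diff_def
    by (rule L2_cls_cong) (use L2_rep_cls(2)[OF f] L2_rep_cls(2)[OF g] in eventually_elim, simp)
  then show ?thesis
    using L2_fun_diff[OF f g] C
    by (simp add: C_dist_def C_norm_def C_inner_cls power2_eq_square)
qed

lemma L2_fun_indicator:
  assumes "A \<in> sets (lebesgue_on S)" "emeasure (lebesgue_on S) A < \<infinity>"
  shows "(\<lambda>x. c * indicator A x) \<in> L2_fun S"
proof -
  have "(\<lambda>x. (c * indicator A x)\<^sup>2) = (\<lambda>x. c\<^sup>2 * indicator A x)"
    by (auto simp: fun_eq_iff indicator_def)
  then show ?thesis
    using assms by (auto simp: L2_fun_def)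
qed

lemma admissible_stresses_interior_empty:
  fixes a b c0 :: real
  assumes "a < b"
    and C: "C \<in> borel_measurable (lebesgue_on {a<..<b})" and c0: "0 < c0"
    and lo: "AE x in lebesgue_on {a<..<b}. c0 \<le> C x"
    and m: "\<sigma>m \<in> Linf (lebesgue_on {a<..<b})" and p: "\<sigma>p \<in> Linf (lebesgue_on {a<..<b})"
  shows "C_topology {a<..<b} C interior_of admissible_stresses {a<..<b} \<sigma>m \<sigma>p = {}"
proof (rule ccontr)
  let ?S = "{a<..<b}" and ?M = "lebesgue_on {a<..<b}"
  interpret Metric_space "L2 ?S" "C_dist ?S C"
    by (rule Metric_space_C_dist[OF C c0 lo])
  assume "\<not> ?thesis"
  then obtain X where X: "X \<in> mtopology interior_of admissible_stresses ?S \<sigma>m \<sigma>p"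
    by (auto simp: C_topology_def)
  then obtain r where r: "0 < r" "mball X r \<subseteq> admissible_stresses ?S \<sigma>m \<sigma>p"
    by (meson interior_of_subset openin_interior_of openin_mtopology subset_trans)
  have "X \<in> admissible_stresses ?S \<sigma>m \<sigma>p"
    by (rule subsetD[OF interior_of_subset X])
  then obtain f where f: "f \<in> L2_fun ?S" "X = L2_cls ?S f" "AE x in ?M. \<sigma>m x \<le> f x"
    unfolding admissible_stresses_def by auto
  obtain Km where Km: "AE x in ?M. \<bar>\<sigma>m x\<bar> \<le> Km" using m by (auto simp: Linf_def)
  obtain Kp where Kp: "AE x in ?M. \<bar>\<sigma>p x\<bar> \<le> Kp" using p by (auto simp: Linf_def)
  \<comment> \<open>The jump height: from \<open>f x \<ge> -Km\<close> follows
    \<open>f x + k \<ge> Kp + 1\<close>, and the summand 1 puts this strictly above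
    \<open>\<sigma>p x\<close>.\<close>
  define k where "k = Km + Kp + 1"
  \<comment> \<open>The bound \<open>b - a\<close> keeps the perturbed interval inside the rod. The
    other bound makes the squared distance, at most \<open>k\<^sup>2 / c0 * d\<close>, less than
    \<open>r\<^sup>2\<close>; the added 1 gives strictness and a positive denominator even if
    \<open>k = 0\<close>.\<close>
  define d where "d = min (b - a) (r\<^sup>2 * c0 / (k\<^sup>2 + 1))"
  have k1: "0 < k\<^sup>2 + 1" by (simp add: add_nonneg_pos)
  have d: "0 < d" "d \<le> b - a"
    using \<open>a < b\<close> \<open>0 < r\<close> c0 k1 by (auto simp: d_def)
  have small: "k\<^sup>2 / c0 * d < r\<^sup>2"
  proof -
    have "k\<^sup>2 / c0 * d \<le> k\<^sup>2 / c0 * (r\<^sup>2 * c0 / (k\<^sup>2 + 1))"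
      using c0 by (intro mult_left_mono) (auto simp: d_def)
    also have "\<dots> = r\<^sup>2 * (k\<^sup>2 / (k\<^sup>2 + 1))"
      using c0 by simp
    also have "\<dots> < r\<^sup>2 * 1"
      using \<open>0 < r\<close> k1 by (intro mult_strict_left_mono) auto
    finally show ?thesis by simp
  qed
  define A where "A = {a<..<a + d}"
  have A: "A \<subseteq> ?S" "A \<in> sets lebesgue" "A \<in> sets ?M"
    using d by (auto simp: A_def sets_restrict_space_iff)
  have eA: "emeasure ?M A = ennreal d"
    using A d by (simp add: emeasure_restrict_space) (simp add: A_def)
  then have mA: "measure ?M A = d"
    using d by (simp add: measure_def)
  define h where "h = (\<lambda>x. k * indicator A x)"
  have h: "h \<in> L2_fun ?S"
    unfolding h_def by (rule L2_fun_indicator) (use A eA in auto)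
  define g where "g = (\<lambda>x. f x + h x)"
  have g: "g \<in> L2_fun ?S"
    \<comment> \<open>The sum \<open>f + h\<close> is read as the difference
      \<open>f - (-h)\<close>.\<close>
    using L2_fun_diff[OF f(1) L2_fun_uminus[OF h]] by (simp add: g_def)
  \<comment> \<open>Since \<open>f - g = -h\<close>, the integrand vanishes off \<open>A\<close> and
    is at most \<open>k\<^sup>2 / c0\<close> on it.\<close>
  have "(LINT x|?M. (f x - g x)\<^sup>2 / C x) \<le> (LINT x|?M. k\<^sup>2 / c0 * indicator A x)"
  proof (rule integral_mono_AE)
    show "integrable ?M (\<lambda>x. (f x - g x)\<^sup>2 / C x)"
      using L2_fun_prod_integrable[OF h h C c0 lo] by (simp add: g_def power2_eq_square)
    show "integrable ?M (\<lambda>x. k\<^sup>2 / c0 * indicator A x)"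
      using A eA by auto
    show "AE x in ?M. (f x - g x)\<^sup>2 / C x \<le> k\<^sup>2 / c0 * indicator A x"
      using lo by eventually_elim
        (use c0 in \<open>auto simp: g_def h_def indicator_def intro!: divide_left_mono\<close>)
  qed
  also have "\<dots> = k\<^sup>2 / c0 * d"
    using A mA by (simp add: Int_absorb2)
  finally have "C_dist ?S C X (L2_cls ?S g) < r"
    using small \<open>0 < r\<close> unfolding f(2) C_dist_cls[OF f(1) g C] by (intro real_less_lsqrt) auto
  then have "L2_cls ?S g \<in> mball X r"
    using f(1,2) g by (simp add: in_mball) (simp add: L2_def)
  then have "L2_cls ?S g \<in> admissible_stresses ?S \<sigma>m \<sigma>p"
    using r by blast
  \<comment> \<open>Admissibility of a class only provides some representative \<open>\<tau>\<close>
    below \<open>\<sigma>p\<close>; the bound reaches \<open>g\<close> because \<open>g\<close> and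
    \<open>\<tau>\<close> agree a.e.\<close>
  then obtain \<tau> where \<tau>: "L2_cls ?S g = L2_cls ?S \<tau>" "AE x in ?M. \<tau> x \<le> \<sigma>p x"
    unfolding admissible_stresses_def by auto
  have "g \<in> L2_cls ?S \<tau>"
    using g unfolding \<tau>(1)[symmetric] by (simp add: L2_cls_def)
  then have "AE x in ?M. g x = \<tau> x"
    by (simp add: L2_cls_def)
  \<comment> \<open>At almost every point of \<open>A\<close> one would have \<open>Kp + 1 \<le> f x
    + k = g x = \<tau> x \<le> \<sigma>p x \<le> Kp\<close>, so \<open>A\<close> would be null,
    although its measure is \<open>d > 0\<close>.\<close>
  then have "AE x in ?M. x \<notin> A"
    using \<tau>(2) f(3) Km Kp
    by eventually_elim (auto simp: g_def h_def k_def indicator_def split: if_splits)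
  then have "emeasure ?M A = 0"
    using AE_iff_null_sets[OF A(3)] by auto
  with eA d show False by simp
qed

theorem mainTheorem5:
  fixes a b T c0 C0 :: real
    and C \<sigma>m \<sigma>p ua ub :: "real \<Rightarrow> real"
    and F :: "real \<Rightarrow> real \<Rightarrow> real"
  defines "\<Omega> \<equiv> {a<..<b}"
  assumes "a < b" and "0 < T"
    and "C \<in> Linf (lebesgue_on \<Omega>)" and "0 < c0"
    and "AE x in lebesgue_on \<Omega>. c0 \<le> C x \<and> C x \<le> C0"
    and "ua \<in> W1inf T" and "ub \<in> W1inf T"
    and "\<And>t. t \<in> {0<..T} \<Longrightarrow> a + ua t < b + ub t"
    and "F \<in> W1inf_L2 T \<Omega>"
    and "\<sigma>m \<in> Linf (lebesgue_on \<Omega>)" and "\<sigma>p \<in> Linf (lebesgue_on \<Omega>)"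
    and "AE x in lebesgue_on \<Omega>. \<sigma>m x < 0 \<and> 0 < \<sigma>p x"
  shows "C_topology \<Omega> C interior_of admissible_stresses \<Omega> \<sigma>m \<sigma>p = {} \<and>
    \<not> (\<forall>t \<in> {0..T}.
        (\<lambda>X. L2_diff \<Omega> X (L2_cls \<Omega> (elastic_stress a b C ua ub F t))) `
          (C_topology \<Omega> C interior_of admissible_stresses \<Omega> \<sigma>m \<sigma>p)
        \<inter> constant_classes \<Omega> \<noteq> {})"
proof -
  have "C_topology \<Omega> C interior_of admissible_stresses \<Omega> \<sigma>m \<sigma>p = {}"
    unfolding \<Omega>_def
  proof (rule admissible_stresses_interior_empty[OF assms(2) _ \<open>0 < c0\<close>])
    show "C \<in> borel_measurable (lebesgue_on {a<..<b})"
      using assms(4) by (simp add: \<Omega>_def Linf_def)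
    show "AE x in lebesgue_on {a<..<b}. c0 \<le> C x"
      using assms(6) unfolding \<Omega>_def by simp
  qed (use assms(11,12) in \<open>simp_all add: \<Omega>_def\<close>)
  \<comment> \<open>Every translate of the empty interior is empty, so the condition already fails
    at \<open>t = 0\<close>, which lies in \<open>{0..T}\<close>.\<close>
  then show ?thesis
    using \<open>0 < T\<close> by (auto intro!: bexI[of _ 0])
qed

end
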